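(* Let $G$ be a finitely generated group and let $K$ be a field such that every quadratic equation $x^2+ax+b=0$ with $a,b\in K$ has a root in $K$. Then the set of all characters of representations $G\to SL(2,K)$ forms an affine algebraic variety defined over $K$, and the defining equations are polynomials with integer coefficients. That is, there is a finite subset $F\subset G$ such that the restriction map $f\mapsto f|_F\in K^F$ is injective on the set of $SL(2,K)$ characters of $G$, and its image is the common zero set in $K^F$ of a set of polynomials with integer coefficients.
   Context: The character of a representation (group homomorphism) $\rho:G\to SL(2,K)$ is the function $G\to K$, $g\mapsto\operatorname{tr}\rho(g)$. For a finitely generated group $G$, each $SL(2,K)$ character is determined polynomially by its values on a finite subset of $G$, and it is via such a finite subset that the set of characters is regarded as a subset of an affine space over $K$. *)

theory Defs
  imports
    "HOL-Algebra.Generated_Groups"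
    "HOL-Analysis.Determinants"
    "HOL-Library.Poly_Mapping"
begin

definition finitely_generated_group :: "('g, 'b) monoid_scheme \<Rightarrow> bool" where
  "finitely_generated_group G \<longleftrightarrow>
     group G \<and> (\<exists>S. finite S \<and> S \<subseteq> carrier G \<and> generate G S = carrier G)"

definition SL2 :: "('k::field ^ 2 ^ 2) monoid" where
  "SL2 = \<lparr>carrier = {A. det A = 1}, monoid.mult = (**), one = mat 1\<rparr>"

lemma group_SL2: "group (SL2 :: ('k::field ^ 2 ^ 2) monoid)"
proof (rule groupI)
  fix A :: "'k ^ 2 ^ 2" assume "A \<in> carrier SL2"
  then have d: "det A = 1" by (simp add: SL2_def)
  define B :: "'k ^ 2 ^ 2" where
    "B = vector [vector [A $ 2 $ 2, - A $ 1 $ 2], vector [- A $ 2 $ 1, A $ 1 $ 1]]"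
  have "det B = 1" and "B ** A = mat 1"
    using d by (auto simp: B_def det_2 mat_def vec_eq_iff matrix_matrix_mult_def
        sum_2 forall_2 algebra_simps)
  then show "\<exists>B\<in>carrier SL2. B \<otimes>\<^bsub>SL2\<^esub> A = \<one>\<^bsub>SL2\<^esub>"
    by (auto simp: SL2_def)
qed (auto simp: SL2_def det_mul matrix_mul_assoc)

text \<open>Elements of \<^term>\<open>hom G H\<close> are unconstrained outside the carrier of \<open>G\<close>, so a character
  is made extensional in order to be determined by its values on \<open>G\<close>.\<close>

definition character :: "('g, 'b) monoid_scheme \<Rightarrow> ('g \<Rightarrow> 'k::field ^ 2 ^ 2) \<Rightarrow> 'g \<Rightarrow> 'k" where
  "character G \<rho> = (\<lambda>g\<in>carrier G. trace (\<rho> g))"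

definition SL2_characters :: "('g, 'b) monoid_scheme \<Rightarrow> ('g \<Rightarrow> 'k::field) set" where
  "SL2_characters G = character G ` hom G SL2"

text \<open>Integer polynomials in variables indexed by \<open>'x\<close>: a polynomial maps each monomial, itself
  a finitely supported family of exponents, to its coefficient.\<close>

type_synonym 'x int_mpoly = "('x \<Rightarrow>\<^sub>0 nat) \<Rightarrow>\<^sub>0 int"

definition int_mpolys_in :: "'x set \<Rightarrow> 'x int_mpoly set" where
  "int_mpolys_in F = {p. \<forall>m \<in> Poly_Mapping.keys p. Poly_Mapping.keys m \<subseteq> F}"

definition eval_int_mpoly :: "('x \<Rightarrow> 'k::field) \<Rightarrow> 'x int_mpoly \<Rightarrow> 'k" where
  "eval_int_mpoly v p =
     (\<Sum>m \<in> Poly_Mapping.keys p.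
        of_int (Poly_Mapping.lookup p m) *
        (\<Prod>x \<in> Poly_Mapping.keys m. v x ^ Poly_Mapping.lookup m x))"

text \<open>The affine space \<open>K\<^sup>F\<close> consists of the functions that are \<^term>\<open>undefined\<close> outside \<open>F\<close>.\<close>

definition zero_locus :: "'x set \<Rightarrow> 'x int_mpoly set \<Rightarrow> ('x \<Rightarrow> 'k::field) set" where
  "zero_locus F P = {v \<in> F \<rightarrow>\<^sub>E UNIV. \<forall>p\<in>P. eval_int_mpoly v p = 0}"

end

theory Submission imports Defs begin

text \<open>The proof identifies the \<open>SL(2,K)\<close> characters of \<open>G\<close> with the functions \<open>f: G \<rightarrow> K\<close> satisfying
  \<open>f(1) = 2\<close> and \<open>f(g) f(h) = f(gh) + f(gh\<^sup>-\<^sup>1)\<close>, called trace functions below. Every character is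
  one, because \<open>B + B\<^sup>-\<^sup>1 = tr B\<close> for \<open>B\<close> in \<open>SL(2,K)\<close>. For the converse let \<open>f\<close> be a trace function.

  If \<open>f\<close> takes a value other than 2 at some commutator \<open>[a,b]\<close>, then there are matrices \<open>A\<close>, \<open>B\<close> in
  \<open>SL(2,K)\<close> such that \<open>A\<close>, \<open>B\<close>, \<open>AB\<close> have traces \<open>f(a)\<close>, \<open>f(b)\<close>, \<open>f(ab)\<close>; finding them takes one
  quadratic equation. Moreover \<open>1, A, B, AB\<close> is a basis of the matrix algebra, so \<open>\<rho>(g)\<close> can be
  defined as the matrix whose products with these four have traces \<open>f(g), f(ga), f(gb), f(gab)\<close>.
  Multiplicativity of \<open>\<rho>\<close> follows from a rigidity statement, \<open>skein_eq_0\<close>: a function \<open>\<phi>\<close> with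
  \<open>\<phi>(xky) + \<phi>(xk\<^sup>-\<^sup>1y) = f(k) \<phi>(xy)\<close> that vanishes at \<open>1, a, b, ab\<close> is zero. Indeed
  \<open>\<phi>(hx) = \<phi>(x\<^sup>-\<^sup>1h)\<close> for \<open>x = a, b, ab\<close>, which makes \<open>\<phi>\<close> invariant under left multiplication
  by the commutator \<open>t\<close>, and then \<open>(2 - f(t)) \<phi> = 0\<close>.

  If \<open>f\<close> equals 2 at all commutators, then \<open>f\<close> factors through the abelianization, and it is the
  trace of a diagonal representation: either \<open>f\<close> takes only the values \<open>2\<close> and \<open>-2\<close>, or some
  \<open>f(a)\<close> is the sum of two distinct roots \<open>\<xi>, \<eta>\<close> with product 1, and \<open>f = \<alpha> + \<beta>\<close> where
  \<open>f(ag) = \<xi> \<alpha>(g) + \<eta> \<beta>(g)\<close>. No step divides by 2, so the characteristic is arbitrary.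

  Finally, let \<open>S\<close> be a finite set that generates \<open>G\<close> as a monoid, and let \<open>F\<close> consist of the products
  of the words in \<open>S\<close> without repeated letters. The identity
  \<open>f(xsysz) = f(zxs) f(ys) - f(zx) f(y) + f(zxy)\<close> reduces the value at a word with a repeated letter
  to values at shorter words; hence for each \<open>g\<close> there is an integer polynomial \<open>p\<^sub>g\<close> in the variables
  \<open>F\<close> that yields \<open>f(g)\<close> for every trace function \<open>f\<close>. Substituting these polynomials into the
  defining equations of trace functions, together with \<open>x\<^sub>g = p\<^sub>g\<close> for \<open>g\<close> in \<open>F\<close>, gives the
  equations of the variety.\<close>

section \<open>Matrices of size two\<close>

lemma matrix_2_eq_iff:
  fixes A B :: "'k::field ^ 2 ^ 2"
  shows "A = B \<longleftrightarrow> A$1$1 = B$1$1 \<and> A$1$2 = B$1$2 \<and> A$2$1 = B$2$1 \<and> A$2$2 = B$2$2"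
  by (auto simp: vec_eq_iff forall_2)

lemma trace_2: "trace (A :: 'k::field ^ 2 ^ 2) = A$1$1 + A$2$2"
  by (simp add: trace_def sum_2)

lemma matrix_mult_2:
  fixes A B :: "'k::field ^ 2 ^ 2"
  shows "(A ** B)$i$j = A$i$1 * B$1$j + A$i$2 * B$2$j"
  by (simp add: matrix_matrix_mult_def sum_2)

lemma mat_2:
  "(mat c :: 'k::field ^ 2 ^ 2)$1$1 = c" "(mat c :: 'k::field ^ 2 ^ 2)$2$2 = c"
  "(mat c :: 'k::field ^ 2 ^ 2)$1$2 = 0" "(mat c :: 'k::field ^ 2 ^ 2)$2$1 = 0"
  by (simp_all add: mat_def)

lemmas matrix_2 = matrix_2_eq_iff trace_2 det_2 matrix_mult_2 mat_2

lemma cramer_2: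
  fixes a b c d :: "'k::field"
  assumes "a * d - b * c \<noteq> 0"
  shows "a * q + b * p = \<alpha> \<and> c * q + d * p = \<beta> \<longleftrightarrow>
    q = (d * \<alpha> - b * \<beta>) / (a * d - b * c) \<and> p = (a * \<beta> - c * \<alpha>) / (a * d - b * c)"
proof
  assume *: "a * q + b * p = \<alpha> \<and> c * q + d * p = \<beta>"
  have "q * (a * d - b * c) = d * (a * q + b * p) - b * (c * q + d * p)"
       "p * (a * d - b * c) = a * (c * q + d * p) - c * (a * q + b * p)"
    by (simp_all add: algebra_simps)
  thus "q = (d * \<alpha> - b * \<beta>) / (a * d - b * c) \<and> p = (a * \<beta> - c * \<alpha>) / (a * d - b * c)"
    using assms * by (simp add: nonzero_eq_divide_eq)
next
  assume *: "q = (d * \<alpha> - b * \<beta>) / (a * d - b * c) \<and> p = (a * \<beta> - c * \<alpha>) / (a * d - b * c)"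
  have "a * (d * \<alpha> - b * \<beta>) + b * (a * \<beta> - c * \<alpha>) = \<alpha> * (a * d - b * c)"
       "c * (d * \<alpha> - b * \<beta>) + d * (a * \<beta> - c * \<alpha>) = \<beta> * (a * d - b * c)"
    by (simp_all add: algebra_simps)
  thus "a * q + b * p = \<alpha> \<and> c * q + d * p = \<beta>"
    using assms * by (simp add: add_divide_distrib [symmetric])
qed

text \<open>The exclusion \<open>x\<^sup>2 + y\<^sup>2 + z\<^sup>2 - xyz \<noteq> 4\<close> says that the commutator of \<open>A\<close> and \<open>B\<close> does not have trace 2.
  It makes the four traces below a coordinate system on the space of matrices.\<close>

lemma matrix_coordinates:
  fixes x y z :: "'k::field"
  assumes quad: "\<forall>a b :: 'k. \<exists>x. x ^ 2 + a * x + b = 0"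
    and ne: "x\<^sup>2 + y\<^sup>2 + z\<^sup>2 - x * y * z \<noteq> 4"
  obtains A B :: "'k ^ 2 ^ 2" where "det A = 1" "det B = 1"
    "trace A = x" "trace B = y" "trace (A ** B) = z"
    "\<And>u1 u2 u3 u4. \<exists>!X. trace X = u1 \<and> trace (X ** A) = u2 \<and> trace (X ** B) = u3 \<and>
        trace (X ** (A ** B)) = u4"
proof -
  obtain r where r: "r\<^sup>2 + z * r + 1 = 0" using quad by blast
  define w where "w = z + r"
  have rw: "r * w = -1" using r unfolding w_def by algebra
  have z: "z = w - r" by (simp add: w_def)
  \<comment> \<open>With this companion matrix \<open>A\<close> and zero as the first entry of \<open>B\<close>, the conditions on \<open>B\<close>
    reduce to the quadratic equation for \<open>r\<close>.\<close>
  define A :: "'k ^ 2 ^ 2" where "A = vector [vector [x, -1], vector [1, 0]]"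
  define B :: "'k ^ 2 ^ 2" where "B = vector [vector [0, w], vector [r, y]]"
  define S where "S = r + w"
  define U where "U = r * x + y"
  define V where "V = x * w - y"
  define D where "D = S * (- S) - (- U) * V"
  have "D = 4 - (x\<^sup>2 + y\<^sup>2 + z\<^sup>2 - x * y * z)"
    unfolding D_def S_def U_def V_def z using rw by algebra
  hence D: "D \<noteq> 0" using ne by auto
  show ?thesis
  proof (rule that[of A B])
    show "det A = 1" "det B = 1" "trace A = x" "trace B = y" "trace (A ** B) = z"
      using rw by (simp_all add: A_def B_def matrix_2 z mult.commute)
    fix u1 u2 u3 u4 :: 'k
    \<comment> \<open>Eliminating two entries of \<open>Y\<close> leaves a linear system with determinant \<open>D\<close> in \<open>Y$2$1\<close> and \<open>Y$1$1\<close>,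
      with right-hand sides \<open>\<alpha>\<close> and \<open>\<beta>\<close>.\<close>
    define \<alpha> where "\<alpha> = u3 - r * u2 - y * u1"
    define \<beta> where "\<beta> = u4 - w * u1"
    define q1 where "q1 = ((- S) * \<alpha> - (- U) * \<beta>) / D"
    define p1 where "p1 = (S * \<beta> - V * \<alpha>) / D"
    define X :: "'k ^ 2 ^ 2" where
      "X = vector [vector [p1, u2 - x * p1 + q1], vector [q1, u1 - p1]]"
    have sys: "S * q + (- U) * p = \<alpha> \<and> V * q + (- S) * p = \<beta> \<longleftrightarrow> q = q1 \<and> p = p1" for p q
      using cramer_2[of S "- S" "- U" V q p \<alpha> \<beta>] D unfolding q1_def p1_def D_def by blast
    have eq: "trace Y = u1 \<and> trace (Y ** A) = u2 \<and> trace (Y ** B) = u3 \<and> trace (Y ** (A ** B)) = u4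
      \<longleftrightarrow> Y = X" for Y
    proof -
      have "trace Y = u1 \<and> trace (Y ** A) = u2 \<and> trace (Y ** B) = u3 \<and> trace (Y ** (A ** B)) = u4
        \<longleftrightarrow> Y$2$2 = u1 - Y$1$1 \<and> Y$1$2 = u2 - x * Y$1$1 + Y$2$1 \<and>
          (S * Y$2$1 + (- U) * Y$1$1 = \<alpha> \<and> V * Y$2$1 + (- S) * Y$1$1 = \<beta>)"
        (is "?l \<longleftrightarrow> ?r")
      proof
        assume ?l
        hence u: "u1 = trace Y" "u2 = trace (Y ** A)" "u3 = trace (Y ** B)" "u4 = trace (Y ** (A ** B))"
          by auto
        show ?r unfolding \<alpha>_def \<beta>_def u A_def B_def S_def U_def V_def
          by (simp add: matrix_2 algebra_simps)
      next
        assume r: ?r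
        hence e: "Y$2$2 = u1 - Y$1$1" "Y$1$2 = u2 - x * Y$1$1 + Y$2$1" by auto
        have u: "u3 = S * Y$2$1 - U * Y$1$1 + r * u2 + y * u1"
          "u4 = V * Y$2$1 - S * Y$1$1 + w * u1"
          using r unfolding \<alpha>_def \<beta>_def by (auto simp: algebra_simps)
        show ?l unfolding A_def B_def u S_def U_def V_def
          by (simp add: matrix_2 e algebra_simps)
      qed
      also have "\<dots> \<longleftrightarrow> Y = X" unfolding sys by (auto simp: X_def matrix_2_eq_iff)
      finally show ?thesis .
    qed
    show "\<exists>!Y. trace Y = u1 \<and> trace (Y ** A) = u2 \<and> trace (Y ** B) = u3 \<and> trace (Y ** (A ** B)) = u4"
      unfolding eq by simp
  qed
qed

lemma SL2_trace_identity:
  fixes A B C :: "'k::field ^ 2 ^ 2"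
  assumes "det B = 1" "B ** C = mat 1"
  shows "trace A * trace B = trace (A ** B) + trace (A ** C)"
proof -
  define D :: "'k ^ 2 ^ 2" where
    "D = vector [vector [B $ 2 $ 2, - B $ 1 $ 2], vector [- B $ 2 $ 1, B $ 1 $ 1]]"
  have "D ** B = mat 1" using assms(1) by (simp add: D_def matrix_2 algebra_simps)
  hence "C = D" by (metis assms(2) matrix_mul_assoc matrix_mul_lid matrix_mul_rid)
  thus ?thesis by (simp add: D_def matrix_2 algebra_simps)
qed

lemma trace_mult_square:
  fixes A X Y :: "'k::field ^ 2 ^ 2"
  shows "trace (X ** A ** (A ** Y)) = trace A * trace (X ** A ** Y) - det A * trace (X ** Y)"
  by (simp add: matrix_2 algebra_simps)

lemma trace_mult_swap:
  fixes A B X :: "'k::field ^ 2 ^ 2"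
  shows "trace (X ** B ** A) = (trace (A ** B) - trace A * trace B) * trace X
    - trace (X ** (A ** B)) + trace A * trace (X ** B) + trace B * trace (X ** A)"
  by (simp add: matrix_2 algebra_simps)

lemma trace_mult_sandwich:
  fixes A B X :: "'k::field ^ 2 ^ 2"
  shows "trace (X ** B ** (A ** B)) = trace (A ** B) * trace (X ** B)
    - det B * (trace A * trace X - trace (X ** A))"
  by (simp add: matrix_2 algebra_simps)

lemma trace_mat_1: "trace (mat 1 :: 'k::field ^ 2 ^ 2) = 2"
  by (simp add: matrix_2)

lemma matrix_add_rdistrib_2:
  fixes A B C :: "'k::field ^ 2 ^ 2"
  shows "(A + B) ** C = A ** C + B ** C"
  by (simp add: matrix_2 algebra_simps)

lemma trace_mat_mult: "trace (mat c ** (X :: 'k::field ^ 2 ^ 2)) = c * trace X"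
  by (simp add: matrix_2 algebra_simps)

lemma trace_mult_mat: "trace (Z ** (mat c ** (X :: 'k::field ^ 2 ^ 2))) = c * trace (Z ** X)"
  by (simp add: matrix_2 algebra_simps)

text \<open>The second assumption makes \<open>B\<close> the adjugate of \<open>A\<close>.\<close>

lemma det_eq_1_if_mult_adjugate:
  fixes A B :: "'k::field ^ 2 ^ 2"
  assumes "A ** B = mat 1" "A + B = mat (trace A)"
  shows "det A = 1"
proof -
  have "A$1$1 * B$1$1 + A$1$2 * B$2$1 = 1" using assms(1) by (simp add: matrix_2)
  moreover have "B$1$1 = A$2$2" "B$2$1 = - A$2$1"
    using assms(2) by (auto simp: matrix_2 add.commute eq_neg_iff_add_eq_0)
  ultimately show ?thesis by (simp add: det_2)
qed

section \<open>Trace functions and skein relations\<close>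

text \<open>The functions with the two trace identities of \<open>SL(2,K)\<close>. Only values on the carrier of \<open>G\<close> are
  constrained.\<close>

locale trace_function = group G for G :: "('g, 'b) monoid_scheme" (structure) +
  fixes f :: "'g \<Rightarrow> 'k::field"
  assumes f_one: "f \<one> = 2"
    and f_mult: "\<lbrakk>g \<in> carrier G; h \<in> carrier G\<rbrakk> \<Longrightarrow> f g * f h = f (g \<otimes> h) + f (g \<otimes> inv h)"
begin

lemma inv_mult_cancel [simp]:
  assumes "x \<in> carrier G" "y \<in> carrier G"
  shows "inv x \<otimes> (x \<otimes> y) = y" "x \<otimes> (inv x \<otimes> y) = y"
  using assms by (simp_all add: m_assoc[symmetric])

lemma f_inv: assumes "g \<in> carrier G" shows "f (inv g) = f g"
  using f_mult[of \<one> g] assms by (simp add: f_one)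

lemma f_commute:
  assumes "g \<in> carrier G" "h \<in> carrier G"
  shows "f (g \<otimes> h) = f (h \<otimes> g)"
proof -
  have "f (inv (g \<otimes> inv h)) = f (g \<otimes> inv h)" using assms by (intro f_inv) auto
  hence "f (h \<otimes> inv g) = f (g \<otimes> inv h)" using assms by (simp add: inv_mult_group)
  thus ?thesis using f_mult[of g h] f_mult[of h g] assms by (simp add: mult.commute)
qed

text \<open>The linear form of the second trace identity. The functions \<open>h \<mapsto> f(gh)\<close> have this property, and
  so does every linear functional of \<open>\<rho>(h)\<close> for a representation \<open>\<rho>\<close> in \<open>SL(2,K)\<close> with trace \<open>f\<close>.\<close>

definition skein :: "('g \<Rightarrow> 'k) \<Rightarrow> bool" where
  "skein \<phi> \<longleftrightarrow> (\<forall>x\<in>carrier G. \<forall>k\<in>carrier G. \<forall>y\<in>carrier G.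
     \<phi> (x \<otimes> k \<otimes> y) + \<phi> (x \<otimes> inv k \<otimes> y) = f k * \<phi> (x \<otimes> y))"

lemma skeinD:
  assumes "skein \<phi>" "x \<in> carrier G" "k \<in> carrier G" "y \<in> carrier G"
  shows "\<phi> (x \<otimes> (k \<otimes> y)) = f k * \<phi> (x \<otimes> y) - \<phi> (x \<otimes> (inv k \<otimes> y))"
proof -
  have "\<phi> (x \<otimes> k \<otimes> y) + \<phi> (x \<otimes> inv k \<otimes> y) = f k * \<phi> (x \<otimes> y)"
    using assms unfolding skein_def by blast
  thus ?thesis using assms by (simp add: m_assoc algebra_simps)
qed

lemma skein_left:
  assumes "skein \<phi>" "k \<in> carrier G" "y \<in> carrier G"
  shows "\<phi> (k \<otimes> y) = f k * \<phi> y - \<phi> (inv k \<otimes> y)"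
  using skeinD[of \<phi> \<one> k y] assms by simp

lemma skein_right:
  assumes "skein \<phi>" "x \<in> carrier G" "k \<in> carrier G"
  shows "\<phi> (x \<otimes> k) = f k * \<phi> x - \<phi> (x \<otimes> inv k)"
  using skeinD[of \<phi> x k \<one>] assms by simp

lemma skein_translate:
  assumes "g \<in> carrier G" shows "skein (\<lambda>h. f (g \<otimes> h))"
  unfolding skein_def
proof (intro ballI)
  fix x k y assume c: "x \<in> carrier G" "k \<in> carrier G" "y \<in> carrier G"
  have *: "f (g \<otimes> (x \<otimes> l \<otimes> y)) = f (y \<otimes> g \<otimes> x \<otimes> l)" if "l \<in> carrier G" for l
    using f_commute[of "g \<otimes> x \<otimes> l" y] assms c that by (simp add: m_assoc)
  have "f (y \<otimes> g \<otimes> x) = f (g \<otimes> (x \<otimes> y))"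
    using f_commute[of "g \<otimes> x" y] assms c by (simp add: m_assoc)
  thus "f (g \<otimes> (x \<otimes> k \<otimes> y)) + f (g \<otimes> (x \<otimes> inv k \<otimes> y)) = f k * f (g \<otimes> (x \<otimes> y))"
    using f_mult[of "y \<otimes> g \<otimes> x" k] assms c by (simp add: * mult.commute)
qed

lemma skein_f: "skein f"
proof -
  have "skein (\<lambda>h. f (\<one> \<otimes> h))" by (rule skein_translate) simp
  thus ?thesis by (simp add: skein_def)
qed

lemma skein_linear_combination:
  assumes "skein \<phi>" "skein \<psi>" shows "skein (\<lambda>h. c * \<phi> h + d * \<psi> h)"
  unfolding skein_def
proof (intro ballI)
  fix x k y assume c: "x \<in> carrier G" "k \<in> carrier G" "y \<in> carrier G"
  from assms c have eq: "\<phi> (x \<otimes> k \<otimes> y) = f k * \<phi> (x \<otimes> y) - \<phi> (x \<otimes> inv k \<otimes> y)"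
    "\<psi> (x \<otimes> k \<otimes> y) = f k * \<psi> (x \<otimes> y) - \<psi> (x \<otimes> inv k \<otimes> y)"
    unfolding skein_def eq_diff_eq by blast+
  show "c * \<phi> (x \<otimes> k \<otimes> y) + d * \<psi> (x \<otimes> k \<otimes> y)
      + (c * \<phi> (x \<otimes> inv k \<otimes> y) + d * \<psi> (x \<otimes> inv k \<otimes> y))
    = f k * (c * \<phi> (x \<otimes> y) + d * \<psi> (x \<otimes> y))"
    unfolding eq by (simp add: algebra_simps)
qed

lemma skein_flip:
  assumes "skein \<phi>" "\<phi> \<one> = 0" "\<phi> x = 0" and c: "x \<in> carrier G" "h \<in> carrier G"
  shows "\<phi> (h \<otimes> x) = \<phi> (inv x \<otimes> h)"
proof -
  have neg: "\<phi> (inv k) = - \<phi> k" if "k \<in> carrier G" for k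
    using skein_right[OF assms(1), of \<one> k] that assms(2) by (simp add: eq_neg_iff_add_eq_0 add.commute)
  have "\<phi> (h \<otimes> x) = - \<phi> (inv x \<otimes> inv h)"
    using neg[of "h \<otimes> x"] c by (simp add: inv_mult_group)
  also have "\<dots> = \<phi> (inv x \<otimes> h)"
    using skein_right[OF assms(1), of "inv x" h] neg[of x] c assms(3) by simp
  finally show ?thesis .
qed

text \<open>Invariance under \<open>t\<close> turns \<open>\<phi>(th) + \<phi>(t\<^sup>-\<^sup>1h) = f(t) \<phi>(h)\<close> into \<open>2 \<phi>(h) = f(t) \<phi>(h)\<close>.\<close>

lemma skein_eq_0_if_invariant:
  assumes "skein \<phi>" "t \<in> carrier G" "f t \<noteq> 2"
    and inv: "\<And>h. h \<in> carrier G \<Longrightarrow> \<phi> (t \<otimes> h) = \<phi> h" and c: "h \<in> carrier G"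
  shows "\<phi> h = 0"
proof -
  have "\<phi> (inv t \<otimes> h) = \<phi> h"
    using inv[of "inv t \<otimes> h"] assms(2) c by (simp add: m_assoc[symmetric])
  hence "(f t - 2) * \<phi> h = 0"
    using skein_left[OF assms(1), of t h] inv[of h] assms(2) c by (simp add: algebra_simps)
  thus ?thesis using assms(3) by simp
qed

text \<open>Rigidity: four values determine a solution of the skein relations, as they determine a linear
  functional on the algebra of 2 by 2 matrices.\<close>

lemma skein_eq_0:
  assumes "skein \<phi>" and c: "a \<in> carrier G" "b \<in> carrier G"
    and ne: "f (inv a \<otimes> inv b \<otimes> a \<otimes> b) \<noteq> 2"
    and z: "\<phi> \<one> = 0" "\<phi> a = 0" "\<phi> b = 0" "\<phi> (a \<otimes> b) = 0"
    and h: "h \<in> carrier G"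
  shows "\<phi> h = 0"
proof (rule skein_eq_0_if_invariant[OF assms(1) _ ne _ h])
  note flip = skein_flip[OF assms(1) z(1)]
  fix h assume h: "h \<in> carrier G"
  define u where "u = a \<otimes> b \<otimes> h"
  have u: "u \<in> carrier G" using c h by (simp add: u_def)
  \<comment> \<open>Moving \<open>a\<close> and then \<open>b\<close> across \<open>u\<close> has the same effect as moving \<open>ab\<close> in one step.\<close>
  have "\<phi> (inv a \<otimes> (inv b \<otimes> u)) = \<phi> (inv b \<otimes> (u \<otimes> a))"
    using flip[OF z(2) c(1), of "inv b \<otimes> u"] c u by (simp add: m_assoc)
  also have "\<dots> = \<phi> (u \<otimes> a \<otimes> b)"
    using flip[OF z(3) c(2), of "u \<otimes> a"] c u by simp
  also have "\<dots> = \<phi> (inv (a \<otimes> b) \<otimes> u)"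
    using flip[OF z(4), of u] c u by (simp add: m_assoc)
  also have "inv (a \<otimes> b) \<otimes> u = h" using c h by (simp add: u_def inv_solve_left')
  finally show "\<phi> (inv a \<otimes> inv b \<otimes> a \<otimes> b \<otimes> h) = \<phi> h" using c h by (simp add: u_def m_assoc)
qed (use c in auto)

text \<open>Fricke's formula for the trace of a commutator.\<close>

lemma f_commutator:
  assumes c: "a \<in> carrier G" "b \<in> carrier G"
  shows "f (inv a \<otimes> inv b \<otimes> a \<otimes> b) = (f a)\<^sup>2 + (f b)\<^sup>2 + (f (a \<otimes> b))\<^sup>2 - f a * f b * f (a \<otimes> b) - 2"
proof -
  have 1: "f (inv b \<otimes> a \<otimes> b) = f a"
    using f_commute[of "inv b" "a \<otimes> b"] c by (simp add: m_assoc)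
  have "f (inv a \<otimes> (inv b \<otimes> a \<otimes> b)) = f a * f (inv b \<otimes> a \<otimes> b) - f (a \<otimes> (inv b \<otimes> a \<otimes> b))"
    using skein_left[OF skein_f, of a "inv b \<otimes> a \<otimes> b"] c by simp
  also have "f (a \<otimes> (inv b \<otimes> a \<otimes> b)) = f (a \<otimes> inv b) * f (a \<otimes> b) - f (a \<otimes> inv b \<otimes> inv (a \<otimes> b))"
    using f_mult[of "a \<otimes> inv b" "a \<otimes> b"] c by (simp add: m_assoc)
  also have "f (a \<otimes> inv b \<otimes> inv (a \<otimes> b)) = f (b \<otimes> b)"
  proof -
    have "f (a \<otimes> inv b \<otimes> inv (a \<otimes> b)) = f (inv (a \<otimes> b) \<otimes> (a \<otimes> inv b))"
      using f_commute c by simp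
    also have "\<dots> = f (inv (b \<otimes> b))" using c
      by (simp add: inv_mult_group m_assoc)
    finally show ?thesis using f_inv c by simp
  qed
  also have "f (b \<otimes> b) = (f b)\<^sup>2 - 2"
    using f_mult[of b b] c f_one by (simp add: power2_eq_square)
  also have "f (a \<otimes> inv b) = f a * f b - f (a \<otimes> b)" using f_mult[of a b] c by simp
  finally show ?thesis unfolding 1 using c by (simp add: m_assoc power2_eq_square algebra_simps)
qed

lemma f_commutator_eq_2_iff:
  assumes "a \<in> carrier G" "b \<in> carrier G"
  shows "f (inv a \<otimes> inv b \<otimes> a \<otimes> b) = 2 \<longleftrightarrow>
    (f a)\<^sup>2 + (f b)\<^sup>2 + (f (a \<otimes> b))\<^sup>2 - f a * f b * f (a \<otimes> b) = 4"
proof -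
  have "u - 2 = 2 \<longleftrightarrow> u = 4" for u :: 'k by (subst diff_eq_eq) simp
  thus ?thesis unfolding f_commutator[OF assms] .
qed

end

section \<open>Trace functions are characters\<close>

context trace_function begin

lemma irreducible_case:
  assumes quad: "\<forall>a b :: 'k. \<exists>x. x ^ 2 + a * x + b = 0"
    and c: "a \<in> carrier G" "b \<in> carrier G"
    and ne: "f (inv a \<otimes> inv b \<otimes> a \<otimes> b) \<noteq> 2"
  obtains \<rho> where "\<rho> \<in> hom G SL2" "\<And>g. g \<in> carrier G \<Longrightarrow> trace (\<rho> g) = f g"
proof -
  have ne4: "(f a)\<^sup>2 + (f b)\<^sup>2 + (f (a \<otimes> b))\<^sup>2 - f a * f b * f (a \<otimes> b) \<noteq> 4"
    using ne unfolding f_commutator_eq_2_iff[OF c] .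
  obtain A B :: "'k ^ 2 ^ 2" where det: "det A = 1" "det B = 1"
    and tr: "trace A = f a" "trace B = f b" "trace (A ** B) = f (a \<otimes> b)"
    and ex1: "\<And>u1 u2 u3 u4. \<exists>!X. trace X = u1 \<and> trace (X ** A) = u2 \<and> trace (X ** B) = u3 \<and>
        trace (X ** (A ** B)) = u4"
    by (rule matrix_coordinates[OF quad ne4]) (rule that)
  have ext: "X = Y" if "trace X = trace Y" "trace (X ** A) = trace (Y ** A)"
    "trace (X ** B) = trace (Y ** B)" "trace (X ** (A ** B)) = trace (Y ** (A ** B))" for X Y
    using ex1[of "trace Y" "trace (Y ** A)" "trace (Y ** B)" "trace (Y ** (A ** B))"] that by blast
  have "\<exists>\<rho>. \<forall>g. trace (\<rho> g) = f g \<and> trace (\<rho> g ** A) = f (g \<otimes> a) \<and> trace (\<rho> g ** B) = f (g \<otimes> b)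
    \<and> trace (\<rho> g ** (A ** B)) = f (g \<otimes> (a \<otimes> b))"
    using ex1 by (intro choice) blast
  then obtain \<rho> where \<rho>: "\<And>g. trace (\<rho> g) = f g" "\<And>g. trace (\<rho> g ** A) = f (g \<otimes> a)"
    "\<And>g. trace (\<rho> g ** B) = f (g \<otimes> b)" "\<And>g. trace (\<rho> g ** (A ** B)) = f (g \<otimes> (a \<otimes> b))"
    by blast
  have one: "\<rho> \<one> = mat 1"
    by (rule ext) (use c in \<open>simp_all add: \<rho> tr f_one trace_mat_1\<close>)
  \<comment> \<open>Right multiplication by \<open>a\<close> and by \<open>b\<close> follows the same rules for \<open>f\<close> as for traces of matrices.\<close>
  have a: "\<rho> (h \<otimes> a) = \<rho> h ** A" if h: "h \<in> carrier G" for h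
  proof (rule ext)
    note sk = skein_translate[OF h]
    show "trace (\<rho> (h \<otimes> a)) = trace (\<rho> h ** A)" by (simp add: \<rho>)
    show "trace (\<rho> (h \<otimes> a) ** A) = trace (\<rho> h ** A ** A)"
      using trace_mult_square[of "\<rho> h" A "mat 1"] skein_right[OF sk, of a a] h c
      by (simp add: \<rho> tr det m_assoc)
    show "trace (\<rho> (h \<otimes> a) ** B) = trace (\<rho> h ** A ** B)"
      using h c by (simp add: matrix_mul_assoc[symmetric] m_assoc \<rho>)
    show "trace (\<rho> (h \<otimes> a) ** (A ** B)) = trace (\<rho> h ** A ** (A ** B))"
      using trace_mult_square[of "\<rho> h" A B] skein_left[OF sk, of a "a \<otimes> b"] h c
      by (simp add: \<rho> tr det m_assoc matrix_mul_assoc[symmetric])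
  qed
  have b: "\<rho> (h \<otimes> b) = \<rho> h ** B" if h: "h \<in> carrier G" for h
  proof (rule ext)
    note sk = skein_translate[OF h]
    show "trace (\<rho> (h \<otimes> b)) = trace (\<rho> h ** B)" by (simp add: \<rho>)
    have "f (h \<otimes> (b \<otimes> a)) = f (b \<otimes> a) * f h - f (h \<otimes> (inv a \<otimes> inv b))"
      using skein_right[OF sk, of \<one> "b \<otimes> a"] h c by (simp add: inv_mult_group)
    also have "f (h \<otimes> (inv a \<otimes> inv b)) = f a * f (h \<otimes> inv b) - f (h \<otimes> (a \<otimes> inv b))"
      using skein_left[OF sk, of a "inv b"] h c by simp
    also have "f (h \<otimes> inv b) = f b * f h - f (h \<otimes> b)"
      using skein_right[OF sk, of \<one> b] h c by simp
    also have "f (h \<otimes> (a \<otimes> inv b)) = f b * f (h \<otimes> a) - f (h \<otimes> (a \<otimes> b))"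
      using skein_right[OF sk, of a b] h c by simp
    also have "f (b \<otimes> a) = f (a \<otimes> b)" using f_commute c by simp
    finally show "trace (\<rho> (h \<otimes> b) ** A) = trace (\<rho> h ** B ** A)"
      using h c by (simp add: trace_mult_swap \<rho> tr m_assoc algebra_simps)
    show "trace (\<rho> (h \<otimes> b) ** B) = trace (\<rho> h ** B ** B)"
      using trace_mult_square[of "\<rho> h" B "mat 1"] skein_right[OF sk, of b b] h c
      by (simp add: \<rho> tr det m_assoc)
    have "f (h \<otimes> (b \<otimes> (a \<otimes> b))) = f (a \<otimes> b) * f (h \<otimes> b) - f (h \<otimes> (b \<otimes> (inv b \<otimes> inv a)))"
      using skein_right[OF sk, of b "a \<otimes> b"] h c by (simp add: inv_mult_group)
    also have "b \<otimes> (inv b \<otimes> inv a) = inv a" using c by simp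
    also have "f (h \<otimes> inv a) = f a * f h - f (h \<otimes> a)"
      using skein_right[OF sk, of \<one> a] h c by simp
    finally show "trace (\<rho> (h \<otimes> b) ** (A ** B)) = trace (\<rho> h ** B ** (A ** B))"
      using h c by (simp add: trace_mult_sandwich \<rho> tr det m_assoc algebra_simps)
  qed
  have ab: "\<rho> (h \<otimes> (a \<otimes> b)) = \<rho> h ** (A ** B)" if h: "h \<in> carrier G" for h
    using a[OF h] b[of "h \<otimes> a"] h c by (simp add: m_assoc matrix_mul_assoc)
  have skein_\<rho>: "\<rho> (x \<otimes> k \<otimes> y) + \<rho> (x \<otimes> inv k \<otimes> y) = mat (f k) ** \<rho> (x \<otimes> y)"
    if h: "x \<in> carrier G" "k \<in> carrier G" "y \<in> carrier G" for x k y
  proof -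
    have *: "f (x \<otimes> k \<otimes> y \<otimes> e) + f (x \<otimes> inv k \<otimes> y \<otimes> e) = f k * f (x \<otimes> y \<otimes> e)"
      if "e \<in> carrier G" for e
      using skeinD[OF skein_f, of x k "y \<otimes> e"] h that by (simp add: m_assoc)
    show ?thesis
    proof (rule ext)
      show "trace (\<rho> (x \<otimes> k \<otimes> y) + \<rho> (x \<otimes> inv k \<otimes> y)) = trace (mat (f k) ** \<rho> (x \<otimes> y))"
        using *[of \<one>] h by (simp add: trace_mat_mult trace_add \<rho>)
    qed (use * c in \<open>simp_all add: trace_mat_mult trace_add matrix_add_rdistrib_2 \<rho>
        matrix_mul_assoc[symmetric, of "mat (f k)"]\<close>)
  qed
  \<comment> \<open>Both sides satisfy the skein relations in \<open>h\<close> and agree at \<open>1, a, b, ab\<close>.\<close>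
  have tr_mult: "f (g \<otimes> h) = trace (\<rho> g ** \<rho> h)" if g: "g \<in> carrier G" and h: "h \<in> carrier G" for g h
  proof -
    have "skein (\<lambda>h. trace (\<rho> g ** \<rho> h))"
      unfolding skein_def trace_add[symmetric] matrix_add_ldistrib[symmetric] trace_mult_mat[symmetric]
      by (simp add: skein_\<rho>)
    from skein_linear_combination[OF skein_translate[OF g] this, of 1 "-1"]
    have sk: "skein (\<lambda>h. f (g \<otimes> h) - trace (\<rho> g ** \<rho> h))" by simp
    have "f (g \<otimes> h) - trace (\<rho> g ** \<rho> h) = 0"
      by (rule skein_eq_0[OF sk c ne _ _ _ _ h])
        (use g c a[of \<one>] b[of \<one>] ab[of \<one>] in \<open>simp_all add: one \<rho>\<close>)
    thus ?thesis by simp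
  qed
  have mult: "\<rho> (g \<otimes> h) = \<rho> g ** \<rho> h" if g: "g \<in> carrier G" and h: "h \<in> carrier G" for g h
    by (rule ext) (use g h c tr_mult[OF g] a[OF h] b[OF h] ab[OF h] in
        \<open>simp_all add: \<rho> m_assoc matrix_mul_assoc[symmetric, of "\<rho> g"]\<close>)
  have "det (\<rho> g) = 1" if g: "g \<in> carrier G" for g
  proof (rule det_eq_1_if_mult_adjugate)
    show "\<rho> g ** \<rho> (inv g) = mat 1" using g one mult[of g "inv g"] by simp
    show "\<rho> g + \<rho> (inv g) = mat (trace (\<rho> g))"
      using g skein_\<rho>[of \<one> g \<one>] by (simp add: one \<rho>(1))
  qed
  hence "\<rho> \<in> hom G SL2" using mult by (auto simp: hom_def SL2_def)
  thus ?thesis using that \<rho>(1) by blast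
qed

lemma diagonal_representation:
  assumes "\<And>g h. g \<in> carrier G \<Longrightarrow> h \<in> carrier G \<Longrightarrow> \<alpha> (g \<otimes> h) = \<alpha> g * \<alpha> h"
    and "\<And>g h. g \<in> carrier G \<Longrightarrow> h \<in> carrier G \<Longrightarrow> \<beta> (g \<otimes> h) = \<beta> g * \<beta> h"
    and "\<And>g. g \<in> carrier G \<Longrightarrow> \<alpha> g * \<beta> g = 1"
    and "\<And>g. g \<in> carrier G \<Longrightarrow> \<alpha> g + \<beta> g = f g"
  obtains \<rho> where "\<rho> \<in> hom G SL2" "\<And>g. g \<in> carrier G \<Longrightarrow> trace (\<rho> g) = f g"
proof -
  define \<rho> :: "'g \<Rightarrow> 'k ^ 2 ^ 2" where "\<rho> g = vector [vector [\<alpha> g, 0], vector [0, \<beta> g]]" for g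
  show ?thesis
  proof (rule that[of \<rho>])
    show "\<rho> \<in> hom G SL2" using assms(1-3) by (auto simp: hom_def SL2_def \<rho>_def matrix_2)
    show "trace (\<rho> g) = f g" if "g \<in> carrier G" for g
      using assms(4) that by (simp add: \<rho>_def trace_2)
  qed
qed

text \<open>Reducible representations satisfy the assumption on commutators, and the diagonal part of a
  triangular representation has the same character; so a diagonal representation is sought.\<close>

lemma reducible_case:
  assumes quad: "\<forall>a b :: 'k. \<exists>x. x ^ 2 + a * x + b = 0"
    and red: "\<And>a b. a \<in> carrier G \<Longrightarrow> b \<in> carrier G \<Longrightarrow> f (inv a \<otimes> inv b \<otimes> a \<otimes> b) = 2"
  obtains \<rho> where "\<rho> \<in> hom G SL2" "\<And>g. g \<in> carrier G \<Longrightarrow> trace (\<rho> g) = f g"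
proof -
  have rel: "(f t)\<^sup>2 + (f h)\<^sup>2 + (f (t \<otimes> h))\<^sup>2 - f t * f h * f (t \<otimes> h) = 4"
    if "t \<in> carrier G" "h \<in> carrier G" for t h
    using red[OF that] unfolding f_commutator_eq_2_iff[OF that] .
  have unip: "f (t \<otimes> h) = f h" if "f t = 2" "t \<in> carrier G" "h \<in> carrier G" for t h
  proof -
    have "(f (t \<otimes> h) - f h)\<^sup>2 = 0" using rel[OF that(2,3)] that(1)
      by (simp add: power2_eq_square algebra_simps)
    thus ?thesis by simp
  qed
  have neg_unip: "f (t \<otimes> h) = - f h" if "f t = -2" "t \<in> carrier G" "h \<in> carrier G" for t h
  proof -
    have "(f (t \<otimes> h) + f h)\<^sup>2 = 0" using rel[OF that(2,3)] that(1)
      by (simp add: power2_eq_square algebra_simps)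
    thus ?thesis by (simp add: eq_neg_iff_add_eq_0)
  qed
  \<comment> \<open>\<open>gh\<close> and \<open>hg\<close> differ by a commutator, at which \<open>f\<close> has the value 2.\<close>
  have comm: "f (g \<otimes> (h \<otimes> k)) = f (h \<otimes> (g \<otimes> k))"
    if "g \<in> carrier G" "h \<in> carrier G" "k \<in> carrier G" for g h k
  proof -
    have *: "g \<otimes> h \<otimes> inv g \<otimes> inv h \<otimes> (h \<otimes> (g \<otimes> k)) = g \<otimes> (h \<otimes> k)"
    proof -
      have "inv h \<otimes> (h \<otimes> (g \<otimes> k)) = g \<otimes> k" "inv g \<otimes> (g \<otimes> k) = k"
        using that by (simp_all)
      thus ?thesis using that by (simp add: m_assoc)
    qed
    show ?thesis
      using unip[of "g \<otimes> h \<otimes> inv g \<otimes> inv h" "h \<otimes> (g \<otimes> k)"] red[of "inv g" "inv h"] that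
      unfolding * by simp
  qed
  show ?thesis
  proof (cases "\<exists>a\<in>carrier G. (f a)\<^sup>2 \<noteq> 4")
    case False
    hence "f g = 2 \<or> f g = -2" if "g \<in> carrier G" for g
      using that power2_eq_iff[of "f g" 2] by auto
    \<comment> \<open>In characteristic 2 the two values of \<open>f\<close> coincide and \<open>\<epsilon>\<close> is trivial.\<close>
    define \<epsilon> :: "'g \<Rightarrow> 'k" where "\<epsilon> g = (if f g = 2 then 1 else -1)" for g
    have f_cases: "f g = 2 \<and> \<epsilon> g = 1 \<or> f g = -2 \<and> f g \<noteq> 2 \<and> \<epsilon> g = -1" if "g \<in> carrier G" for g
      using \<open>g \<in> carrier G \<Longrightarrow> f g = 2 \<or> f g = -2\<close>[OF that] by (auto simp: \<epsilon>_def)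
    have "\<epsilon> (g \<otimes> h) = \<epsilon> g * \<epsilon> h" if "g \<in> carrier G" "h \<in> carrier G" for g h
      using f_cases[OF that(1)] f_cases[OF that(2)] unip[of g h] neg_unip[of g h] that
      by (auto simp: \<epsilon>_def)
    moreover have "\<epsilon> g * \<epsilon> g = 1" "\<epsilon> g + \<epsilon> g = f g" if "g \<in> carrier G" for g
      using f_cases[OF that] by auto
    ultimately show ?thesis using diagonal_representation[of \<epsilon> \<epsilon>] that by blast
  next
    case True
    then obtain a where a: "a \<in> carrier G" and ne: "(f a)\<^sup>2 \<noteq> 4" by blast
    obtain \<xi> where "\<xi>\<^sup>2 + (- f a) * \<xi> + 1 = 0" using quad by blast
    define \<eta> where "\<eta> = f a - \<xi>"
    have sum: "f a = \<xi> + \<eta>" by (simp add: \<eta>_def)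
    have prod: "\<xi> * \<eta> = 1" using \<open>\<xi>\<^sup>2 + (- f a) * \<xi> + 1 = 0\<close> unfolding \<eta>_def by algebra
    have "(\<xi> - \<eta>)\<^sup>2 = (f a)\<^sup>2 - 4" unfolding sum using prod by algebra
    hence d: "\<xi> - \<eta> \<noteq> 0" using ne by auto
    \<comment> \<open>The solution of \<open>\<alpha>(g) + \<beta>(g) = f(g)\<close> and \<open>\<xi> \<alpha>(g) + \<eta> \<beta>(g) = f(ag)\<close>.\<close>
    define \<alpha> where "\<alpha> g = (f (a \<otimes> g) - \<eta> * f g) / (\<xi> - \<eta>)" for g
    define \<beta> where "\<beta> g = (\<xi> * f g - f (a \<otimes> g)) / (\<xi> - \<eta>)" for g
    have f: "\<alpha> g + \<beta> g = f g" for g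
      using d by (simp add: \<alpha>_def \<beta>_def add_divide_distrib[symmetric] nonzero_divide_eq_eq algebra_simps)
    have fa: "\<xi> * \<alpha> g + \<eta> * \<beta> g = f (a \<otimes> g)" for g
      using d by (simp add: \<alpha>_def \<beta>_def add_divide_distrib[symmetric] nonzero_divide_eq_eq algebra_simps)
    have unique: "u = \<alpha> g \<and> v = \<beta> g" if "u + v = f g" "\<xi> * u + \<eta> * v = f (a \<otimes> g)" for u v g
    proof -
      have "u * (\<xi> - \<eta>) = f (a \<otimes> g) - \<eta> * f g" "v * (\<xi> - \<eta>) = \<xi> * f g - f (a \<otimes> g)"
        unfolding that[symmetric] by (simp_all add: algebra_simps)
      thus ?thesis using d by (simp add: \<alpha>_def \<beta>_def nonzero_eq_divide_eq)
    qed
    have one: "\<alpha> \<one> = 1" "\<beta> \<one> = 1"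
      using unique[of 1 1 \<one>] a sum by (simp_all add: f_one)
    have faa: "f (a \<otimes> (a \<otimes> g)) = f a * f (a \<otimes> g) - f g" if "g \<in> carrier G" for g
      using skein_left[OF skein_f, of a "a \<otimes> g"] a that by simp
    have a_mult: "\<xi> * \<alpha> g = \<alpha> (a \<otimes> g) \<and> \<eta> * \<beta> g = \<beta> (a \<otimes> g)" if "g \<in> carrier G" for g
    proof (rule unique)
      have "\<xi> * (\<xi> * u) + \<eta> * (\<eta> * v) = (\<xi> + \<eta>) * (\<xi> * u + \<eta> * v) - (\<xi> * \<eta>) * (u + v)" for u v
        by (simp add: algebra_simps)
      from this[of "\<alpha> g" "\<beta> g"]
      show "\<xi> * (\<xi> * \<alpha> g) + \<eta> * (\<eta> * \<beta> g) = f (a \<otimes> (a \<otimes> g))"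
        unfolding faa[OF that] f fa prod sum by simp
    qed (simp add: fa)
    have skein: "skein \<alpha>" "skein \<beta>"
      using skein_linear_combination[OF skein_translate[OF a] skein_f, of "1 / (\<xi> - \<eta>)" "- \<eta> / (\<xi> - \<eta>)"]
        skein_linear_combination[OF skein_translate[OF a] skein_f, of "- 1 / (\<xi> - \<eta>)" "\<xi> / (\<xi> - \<eta>)"]
      by (simp_all add: \<alpha>_def[abs_def] \<beta>_def[abs_def] diff_divide_distrib)
    have f_mult: "f (g \<otimes> h) = \<alpha> g * \<alpha> h + \<beta> g * \<beta> h" if g: "g \<in> carrier G" and h: "h \<in> carrier G" for g h
    proof -
      \<comment> \<open>The difference \<open>\<phi>\<close> vanishes at \<open>1\<close> and \<open>a\<close>, and it does not see the order of factors, which makes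
        it invariant under \<open>a\<^sup>2\<close>.\<close>
      define \<phi> where "\<phi> h = f (g \<otimes> h) - (\<alpha> g * \<alpha> h + \<beta> g * \<beta> h)" for h
      have "\<phi> = (\<lambda>h. 1 * f (g \<otimes> h) + (-1) * (\<alpha> g * \<alpha> h + \<beta> g * \<beta> h))"
        by (simp add: \<phi>_def fun_eq_iff)
      hence sk: "skein \<phi>"
        using skein_linear_combination[OF skein_translate[OF g]
            skein_linear_combination[OF skein], of 1 "-1" "\<alpha> g" "\<beta> g"] by simp
      have z: "\<phi> \<one> = 0" using g by (simp add: \<phi>_def one f)
      have "\<alpha> a = \<xi>" "\<beta> a = \<eta>" using a_mult[of \<one>] one a by simp_all
      hence za: "\<phi> a = 0" using fa[of g] f_commute[of g a] g a by (simp add: \<phi>_def mult.commute)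
      have \<phi>_comm: "\<phi> (u \<otimes> v) = \<phi> (v \<otimes> u)" if "u \<in> carrier G" "v \<in> carrier G" for u v
      proof -
        have "f (w \<otimes> (u \<otimes> v)) = f (w \<otimes> (v \<otimes> u))" if w: "w \<in> carrier G" for w
        proof -
          have "f (w \<otimes> (u \<otimes> v)) = f (u \<otimes> (v \<otimes> w))"
            using f_commute[of w "u \<otimes> v"] w \<open>u \<in> _\<close> \<open>v \<in> _\<close> by (simp add: m_assoc)
          also have "\<dots> = f (v \<otimes> (u \<otimes> w))" using comm w \<open>u \<in> _\<close> \<open>v \<in> _\<close> by simp
          also have "\<dots> = f (w \<otimes> (v \<otimes> u))"
            using f_commute[of w "v \<otimes> u"] w \<open>u \<in> _\<close> \<open>v \<in> _\<close> by (simp add: m_assoc)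
          finally show ?thesis .
        qed
        thus ?thesis using that g a f_commute[of u v] by (simp add: \<phi>_def \<alpha>_def \<beta>_def)
      qed
      have "f (a \<otimes> a) = (f a)\<^sup>2 - 2"
        using faa[of \<one>] a by (simp add: f_one power2_eq_square)
      hence "f (a \<otimes> a) \<noteq> 2" using ne by auto
      have "\<phi> h = 0"
      proof (rule skein_eq_0_if_invariant[OF sk _ \<open>f (a \<otimes> a) \<noteq> 2\<close> _ h])
        fix h assume h: "h \<in> carrier G"
        have "\<phi> (a \<otimes> a \<otimes> h) = \<phi> (a \<otimes> h \<otimes> a)"
          using \<phi>_comm[of a "a \<otimes> h"] a h by (simp add: m_assoc)
        also have "\<dots> = \<phi> (inv a \<otimes> (a \<otimes> h))" using skein_flip[OF sk z za] a h by simp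
        also have "inv a \<otimes> (a \<otimes> h) = h" using a h by simp
        finally show "\<phi> (a \<otimes> a \<otimes> h) = \<phi> h" .
      qed (use a in auto)
      thus ?thesis by (simp add: \<phi>_def)
    qed
    have mult: "\<alpha> g * \<alpha> h = \<alpha> (g \<otimes> h) \<and> \<beta> g * \<beta> h = \<beta> (g \<otimes> h)"
      if g: "g \<in> carrier G" and h: "h \<in> carrier G" for g h
    proof (rule unique)
      have "f (a \<otimes> (g \<otimes> h)) = \<alpha> (a \<otimes> g) * \<alpha> h + \<beta> (a \<otimes> g) * \<beta> h"
        using f_mult[of "a \<otimes> g" h] a g h by (simp add: m_assoc)
      thus "\<xi> * (\<alpha> g * \<alpha> h) + \<eta> * (\<beta> g * \<beta> h) = f (a \<otimes> (g \<otimes> h))"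
        using a_mult[OF g] by (simp add: mult.assoc[symmetric])
    qed (use f_mult g h in simp)
    have "\<beta> g = \<alpha> (inv g)" if "g \<in> carrier G" for g
      using skein_right[OF skein_f, of a g] a that unfolding \<alpha>_def \<beta>_def sum
      by (simp add: f_inv algebra_simps)
    hence inverse: "\<alpha> g * \<beta> g = 1" if "g \<in> carrier G" for g
      using mult[of g "inv g"] one that by simp
    show ?thesis
      by (rule diagonal_representation[of \<alpha> \<beta>]) (use mult inverse f that in auto)
  qed
qed

theorem trace_function_imp_character:
  assumes "\<forall>a b :: 'k. \<exists>x. x ^ 2 + a * x + b = 0"
  obtains \<rho> where "\<rho> \<in> hom G SL2" "\<And>g. g \<in> carrier G \<Longrightarrow> trace (\<rho> g) = f g"
proof (cases "\<exists>a\<in>carrier G. \<exists>b\<in>carrier G. f (inv a \<otimes> inv b \<otimes> a \<otimes> b) \<noteq> 2")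
  case True
  thus ?thesis using irreducible_case[OF assms] that by blast
next
  case False
  thus ?thesis using reducible_case[OF assms] that by blast
qed

end

lemma character_is_trace_function:
  assumes "group G" and \<rho>: "\<rho> \<in> hom G SL2"
  shows "trace_function G (character G \<rho>)"
proof -
  interpret group G by fact
  have det: "det (\<rho> g) = 1" if "g \<in> carrier G" for g
    using \<rho> that by (auto simp: hom_def SL2_def)
  have mult: "\<rho> (g \<otimes>\<^bsub>G\<^esub> h) = \<rho> g ** \<rho> h" if "g \<in> carrier G" "h \<in> carrier G" for g h
    using \<rho> that by (auto simp: hom_def SL2_def)
  have one: "\<rho> \<one>\<^bsub>G\<^esub> = mat 1"
    using hom_one[OF \<rho> \<open>group G\<close> group_SL2] by (simp add: SL2_def)
  show ?thesis
  proof unfold_locales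
    show "character G \<rho> \<one>\<^bsub>G\<^esub> = 2" by (simp add: character_def one trace_mat_1)
    fix g h assume c: "g \<in> carrier G" "h \<in> carrier G"
    have "\<rho> h ** \<rho> (inv\<^bsub>G\<^esub> h) = mat 1" using mult[of h "inv\<^bsub>G\<^esub> h"] c one by simp
    from SL2_trace_identity[OF det[OF c(2)] this, of "\<rho> g"]
    show "character G \<rho> g * character G \<rho> h =
        character G \<rho> (g \<otimes>\<^bsub>G\<^esub> h) + character G \<rho> (g \<otimes>\<^bsub>G\<^esub> inv\<^bsub>G\<^esub> h)"
      using c by (simp add: character_def mult)
  qed
qed

section \<open>Evaluation of integer polynomials\<close>

lemma eval_int_mpoly_add:
  "eval_int_mpoly v (p + q) = eval_int_mpoly v p + eval_int_mpoly v q"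
  unfolding eval_int_mpoly_def
  by (rule setsum_keys_plus_distrib) (simp_all add: algebra_simps)

lemma eval_int_mpoly_0 [simp]: "eval_int_mpoly v 0 = 0"
  by (simp add: eval_int_mpoly_def)

lemma eval_int_mpoly_diff:
  "eval_int_mpoly v (p - q) = eval_int_mpoly v p - eval_int_mpoly v q"
  using eval_int_mpoly_add[of v "p - q" q] by simp

lemma eval_int_mpoly_single:
  "eval_int_mpoly v (Poly_Mapping.single m c) =
     of_int c * (\<Prod>x\<in>Poly_Mapping.keys m. v x ^ Poly_Mapping.lookup m x)"
  by (simp add: eval_int_mpoly_def)

lemma monomial_value_add:
  fixes v :: "'x \<Rightarrow> 'k::field" and m n :: "'x \<Rightarrow>\<^sub>0 nat"
  shows "(\<Prod>x\<in>Poly_Mapping.keys (m + n). v x ^ Poly_Mapping.lookup (m + n) x) =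
    (\<Prod>x\<in>Poly_Mapping.keys m. v x ^ Poly_Mapping.lookup m x) *
    (\<Prod>x\<in>Poly_Mapping.keys n. v x ^ Poly_Mapping.lookup n x)"
proof -
  let ?A = "Poly_Mapping.keys m \<union> Poly_Mapping.keys n"
  have *: "(\<Prod>x\<in>Poly_Mapping.keys k. v x ^ Poly_Mapping.lookup k x) =
      (\<Prod>x\<in>?A. v x ^ Poly_Mapping.lookup k x)"
    if "Poly_Mapping.keys k \<subseteq> ?A" for k :: "'x \<Rightarrow>\<^sub>0 nat"
    using that by (intro prod.mono_neutral_left) (auto simp: in_keys_iff)
  have "(\<Prod>x\<in>Poly_Mapping.keys (m + n). v x ^ Poly_Mapping.lookup (m + n) x) =
      (\<Prod>x\<in>?A. v x ^ Poly_Mapping.lookup m x) * (\<Prod>x\<in>?A. v x ^ Poly_Mapping.lookup n x)"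
    unfolding *[OF keys_add] by (simp add: lookup_add power_add prod.distrib)
  thus ?thesis by (simp add: *)
qed

lemma poly_mapping_additive_induct [case_names zero single add]:
  assumes "P 0" "\<And>m c. P (Poly_Mapping.single m c)" "\<And>p q. P p \<Longrightarrow> P q \<Longrightarrow> P (p + q)"
  shows "P (p :: 'a \<Rightarrow>\<^sub>0 'b::comm_monoid_add)"
proof (induction p rule: update_induct)
  case (update p a b)
  have "Poly_Mapping.update a b p = p + Poly_Mapping.single a b"
    using update(1) by (intro poly_mapping_eqI)
      (auto simp: lookup_update lookup_add lookup_single in_keys_iff when_def)
  thus ?case using assms update by simp
qed (fact assms(1))

lemma eval_int_mpoly_mult:
  "eval_int_mpoly v (p * q) = eval_int_mpoly v p * eval_int_mpoly v q"
proof (induction p rule: poly_mapping_additive_induct)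
  case (single m c)
  show ?case
    by (induction q rule: poly_mapping_additive_induct)
      (simp_all add: mult_single eval_int_mpoly_single monomial_value_add
        distrib_left eval_int_mpoly_add algebra_simps)
qed (simp_all add: distrib_right eval_int_mpoly_add)

lemma int_mpolys_in_diff:
  "p \<in> int_mpolys_in F \<Longrightarrow> q \<in> int_mpolys_in F \<Longrightarrow> p - q \<in> int_mpolys_in F"
  using keys_diff[of p q] by (auto simp: int_mpolys_in_def)

lemma int_mpolys_in_mult:
  assumes "p \<in> int_mpolys_in F" "q \<in> int_mpolys_in F"
  shows "p * q \<in> int_mpolys_in F"
  unfolding int_mpolys_in_def
proof (intro CollectI ballI)
  fix m assume "m \<in> Poly_Mapping.keys (p * q)"
  then obtain a b where "m = a + b" "a \<in> Poly_Mapping.keys p" "b \<in> Poly_Mapping.keys q"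
    using keys_mult[of p q] by blast
  thus "Poly_Mapping.keys m \<subseteq> F"
    using assms keys_add[of a b] by (fastforce simp: int_mpolys_in_def)
qed

text \<open>The polynomial that consists of the single variable \<open>x\<close>.\<close>

definition mpoly_var :: "'x \<Rightarrow> 'x int_mpoly" where
  "mpoly_var x = Poly_Mapping.single (Poly_Mapping.single x 1) 1"

lemma mpoly_var_in: "x \<in> F \<Longrightarrow> mpoly_var x \<in> int_mpolys_in F"
  by (simp add: mpoly_var_def int_mpolys_in_def)

lemma eval_mpoly_var [simp]: "eval_int_mpoly v (mpoly_var x) = v x"
  by (simp add: mpoly_var_def eval_int_mpoly_single)

lemma two_in_int_mpolys_in: "2 \<in> int_mpolys_in F"
  by (simp add: int_mpolys_in_def single_numeral[symmetric] del: single_numeral)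

lemma eval_two [simp]: "eval_int_mpoly v 2 = 2"
  using eval_int_mpoly_single[of v 0 2] by simp

text \<open>The function \<open>e\<close> on \<open>T\<close> is an integer polynomial in the values of its argument at the points of
  \<open>F\<close>. The same polynomial serves for all members of \<open>T\<close>.\<close>

definition polynomial_in :: "'x set \<Rightarrow> ('x \<Rightarrow> 'k::field) set \<Rightarrow> (('x \<Rightarrow> 'k) \<Rightarrow> 'k) \<Rightarrow> bool" where
  "polynomial_in F T e \<longleftrightarrow>
     (\<exists>p\<in>int_mpolys_in F. \<forall>f\<in>T. eval_int_mpoly (restrict f F) p = e f)"

lemma polynomial_in_var: "x \<in> F \<Longrightarrow> polynomial_in F T (\<lambda>f. f x)"
  unfolding polynomial_in_def by (rule bexI[of _ "mpoly_var x"]) (simp_all add: mpoly_var_in)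

lemma polynomial_in_diff:
  assumes "polynomial_in F T e" "polynomial_in F T e'"
  shows "polynomial_in F T (\<lambda>f. e f - e' f)"
  using assms unfolding polynomial_in_def by (metis eval_int_mpoly_diff int_mpolys_in_diff)

lemma polynomial_in_mult:
  assumes "polynomial_in F T e" "polynomial_in F T e'"
  shows "polynomial_in F T (\<lambda>f. e f * e' f)"
  using assms unfolding polynomial_in_def by (metis eval_int_mpoly_mult int_mpolys_in_mult)

lemma polynomial_in_cong:
  assumes "polynomial_in F T e" "\<And>f. f \<in> T \<Longrightarrow> e' f = e f"
  shows "polynomial_in F T e'"
  using assms unfolding polynomial_in_def by auto

section \<open>Finitely many values determine a trace function\<close>

context group begin

text \<open>The product in \<open>G\<close> of the letters of a word; the empty word has the value \<open>\<one>\<close>.\<close>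

definition word_value :: "'a list \<Rightarrow> 'a" where
  "word_value ws = foldr (\<otimes>) ws \<one>"

lemma word_value_Nil [simp]: "word_value [] = \<one>"
  and word_value_Cons [simp]: "word_value (w # ws) = w \<otimes> word_value ws"
  by (simp_all add: word_value_def)

lemma word_value_closed [simp]: "set ws \<subseteq> carrier G \<Longrightarrow> word_value ws \<in> carrier G"
  by (induction ws) auto

lemma word_value_append [simp]:
  "set us \<subseteq> carrier G \<Longrightarrow> set ws \<subseteq> carrier G \<Longrightarrow> word_value (us @ ws) = word_value us \<otimes> word_value ws"
  by (induction us) (auto simp: m_assoc)

lemma generate_imp_word_value:
  assumes S: "S \<subseteq> carrier G" and g: "g \<in> generate G S"
  shows "\<exists>ws. set ws \<subseteq> S \<union> (\<lambda>s. inv s) ` S \<and> word_value ws = g"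
  using g
proof (induction rule: generate.induct)
  case one
  show ?case by (rule exI[of _ "[]"]) simp
next
  case (incl h)
  thus ?case using S by (intro exI[of _ "[h]"]) auto
next
  case (inv h)
  thus ?case using S by (intro exI[of _ "[inv h]"]) auto
next
  case (eng g h)
  then obtain us ws where *: "set us \<subseteq> S \<union> (\<lambda>s. inv s) ` S" "word_value us = g"
    "set ws \<subseteq> S \<union> (\<lambda>s. inv s) ` S" "word_value ws = h" by blast
  have "S \<union> (\<lambda>s. inv s) ` S \<subseteq> carrier G" using S by auto
  hence "set us \<subseteq> carrier G" "set ws \<subseteq> carrier G" using * by blast+
  thus ?case using * by (intro exI[of _ "us @ ws"]) auto
qed

end

context trace_function begin

lemma f_repeated_factor:
  assumes c: "x \<in> carrier G" "s \<in> carrier G" "y \<in> carrier G" "z \<in> carrier G"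
  shows "f (x \<otimes> s \<otimes> y \<otimes> s \<otimes> z) =
    f (z \<otimes> x \<otimes> s) * f (y \<otimes> s) - (f (z \<otimes> x) * f y - f (z \<otimes> x \<otimes> y))"
proof -
  have "f (x \<otimes> s \<otimes> y \<otimes> s \<otimes> z) = f ((z \<otimes> x \<otimes> s) \<otimes> (y \<otimes> s))"
    using f_commute[of "x \<otimes> s \<otimes> y \<otimes> s" z] c by (simp add: m_assoc)
  also have "\<dots> = f (z \<otimes> x \<otimes> s) * f (y \<otimes> s) - f (z \<otimes> x \<otimes> inv y)"
    using f_mult[of "z \<otimes> x \<otimes> s" "y \<otimes> s"] c by (simp add: m_assoc inv_mult_group)
  also have "f (z \<otimes> x \<otimes> inv y) = f (z \<otimes> x) * f y - f (z \<otimes> x \<otimes> y)"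
    using f_mult[of "z \<otimes> x" y] c by simp
  finally show ?thesis .
qed

end

text \<open>Induction on the length of the word; a repeated letter is removed by \<open>f_repeated_factor\<close>.\<close>

lemma (in group) word_trace_polynomial:
  fixes T :: "('a \<Rightarrow> 'k::field) set"
  assumes S: "S \<subseteq> carrier G" and T: "\<And>f. f \<in> T \<Longrightarrow> trace_function G f"
    and ws: "set ws \<subseteq> S"
  shows "polynomial_in (word_value ` {ws. set ws \<subseteq> S \<and> distinct ws}) T (\<lambda>f. f (word_value ws))"
    (is "polynomial_in ?F T _")
  using ws
proof (induction "length ws" arbitrary: ws rule: less_induct)
  case less
  show ?case
  proof (cases "distinct ws")
    case True
    thus ?thesis using less.prems by (intro polynomial_in_var) auto
  next
    case False
    then obtain xs ys zs s where ws: "ws = xs @ [s] @ ys @ [s] @ zs"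
      using not_distinct_decomp by blast
    have IH: "polynomial_in ?F T (\<lambda>f. f (word_value us))"
      if "length us < length ws" "set us \<subseteq> set ws" for us
      using less.hyps[of us] less.prems that by blast
    have c: "set xs \<subseteq> carrier G" "s \<in> carrier G" "set ys \<subseteq> carrier G" "set zs \<subseteq> carrier G"
      using less.prems S ws by auto
    have "polynomial_in ?F T (\<lambda>f. f (word_value (zs @ xs @ [s])) * f (word_value (ys @ [s])) -
      (f (word_value (zs @ xs)) * f (word_value ys) - f (word_value (zs @ xs @ ys))))"
      by (intro polynomial_in_diff polynomial_in_mult IH) (auto simp: ws)
    thus ?thesis
    proof (rule polynomial_in_cong)
      fix f assume "f \<in> T"
      then interpret trace_function G f by (rule T)
      show "f (word_value ws) = f (word_value (zs @ xs @ [s])) * f (word_value (ys @ [s])) -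
        (f (word_value (zs @ xs)) * f (word_value ys) - f (word_value (zs @ xs @ ys)))"
        using f_repeated_factor[of "word_value xs" s "word_value ys" "word_value zs"] c
        by (simp add: ws m_assoc)
    qed
  qed
qed

section \<open>The variety of characters\<close>

theorem corollary1p3:
  fixes G :: "('g, 'b) monoid_scheme"
  assumes "finitely_generated_group G"
    and "\<forall>a b :: 'k::field. \<exists>x. x ^ 2 + a * x + b = 0"
  shows "\<exists>F. finite F \<and> F \<subseteq> carrier G \<and>
           inj_on (\<lambda>f. restrict f F) (SL2_characters G :: ('g \<Rightarrow> 'k) set) \<and>
           (\<exists>P \<subseteq> int_mpolys_in F.
              (\<lambda>f. restrict f F) ` (SL2_characters G :: ('g \<Rightarrow> 'k) set) = zero_locus F P)"
proof -
  obtain S where S: "finite S" "S \<subseteq> carrier G" "generate G S = carrier G" and "group G"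
    using assms(1) unfolding finitely_generated_group_def by blast
  interpret group G by fact
  \<comment> \<open>Closing \<open>S\<close> under inverses makes every element the value of a word.\<close>
  define S' where "S' = S \<union> (\<lambda>s. inv\<^bsub>G\<^esub> s) ` S"
  have S': "finite S'" "S' \<subseteq> carrier G" using S by (auto simp: S'_def)
  define F where "F = word_value ` {ws. set ws \<subseteq> S' \<and> distinct ws}"
  have "finite F" unfolding F_def using finite_subset_distinct[OF S'(1)] by simp
  have F: "F \<subseteq> carrier G" unfolding F_def using S'(2) by auto
  define T :: "('g \<Rightarrow> 'k) set" where "T = {f. trace_function G f}"
  have "polynomial_in F T (\<lambda>f. f g)" if g: "g \<in> carrier G" for g
  proof -
    obtain ws where "set ws \<subseteq> S'" "word_value ws = g"
      using generate_imp_word_value[OF S(2), of g] S(3) g unfolding S'_def by blast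
    thus ?thesis using word_trace_polynomial[OF S'(2), of T ws] unfolding F_def T_def by auto
  qed
  hence "\<forall>g\<in>carrier G. \<exists>p. p \<in> int_mpolys_in F \<and>
      (\<forall>f. trace_function G f \<longrightarrow> eval_int_mpoly (restrict f F) p = (f g :: 'k))"
    unfolding polynomial_in_def T_def by blast
  from bchoice[OF this] obtain p where p: "\<And>g. g \<in> carrier G \<Longrightarrow> p g \<in> int_mpolys_in F"
    "\<And>(f :: 'g \<Rightarrow> 'k) g. g \<in> carrier G \<Longrightarrow> trace_function G f \<Longrightarrow>
       eval_int_mpoly (restrict f F) (p g) = f g"
    by blast
  have char: "trace_function G f" if "f \<in> (SL2_characters G :: ('g \<Rightarrow> 'k) set)" for f
    using that character_is_trace_function[OF \<open>group G\<close>] unfolding SL2_characters_def by blast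
  define P where "P = {p \<one>\<^bsub>G\<^esub> - 2}
    \<union> {p g * p h - p (g \<otimes>\<^bsub>G\<^esub> h) - p (g \<otimes>\<^bsub>G\<^esub> inv\<^bsub>G\<^esub> h) | g h. g \<in> carrier G \<and> h \<in> carrier G}
    \<union> {mpoly_var g - p g | g. g \<in> F}"
  have "P \<subseteq> int_mpolys_in F"
    unfolding P_def using p(1) F
    by (auto intro!: int_mpolys_in_diff int_mpolys_in_mult two_in_int_mpolys_in mpoly_var_in)
  moreover have "inj_on (\<lambda>f. restrict f F) (SL2_characters G :: ('g \<Rightarrow> 'k) set)"
  proof (rule inj_onI)
    fix f f' :: "'g \<Rightarrow> 'k"
    assume f: "f \<in> SL2_characters G" "f' \<in> SL2_characters G" and eq: "restrict f F = restrict f' F"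
    have "f \<in> extensional (carrier G)" "f' \<in> extensional (carrier G)"
      using f by (auto simp: SL2_characters_def character_def)
    thus "f = f'"
      by (rule extensionalityI) (use p(2)[OF _ char[OF f(1)]] p(2)[OF _ char[OF f(2)]] eq in metis)
  qed
  moreover have "(\<lambda>f. restrict f F) ` (SL2_characters G :: ('g \<Rightarrow> 'k) set) = zero_locus F P"
  proof (intro equalityI subsetI)
    fix v assume "v \<in> (\<lambda>f. restrict f F) ` (SL2_characters G :: ('g \<Rightarrow> 'k) set)"
    then obtain f where f: "f \<in> SL2_characters G" "v = restrict f F" by blast
    interpret trace_function G f by (rule char[OF f(1)])
    have "eval_int_mpoly v (p g) = f g" if "g \<in> carrier G" for g
      using p(2)[OF that trace_function_axioms] f(2) by simp
    thus "v \<in> zero_locus F P"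
      using F f_one f_mult unfolding zero_locus_def P_def
      by (auto simp: eval_int_mpoly_diff eval_int_mpoly_mult f(2) subset_iff)
  next
    fix v :: "'g \<Rightarrow> 'k" assume v: "v \<in> zero_locus F P"
    define f where "f g = eval_int_mpoly v (p g)" for g
    have zero: "eval_int_mpoly v q = 0" if "q \<in> P" for q
      using v that by (simp add: zero_locus_def)
    have "trace_function G f"
    proof unfold_locales
      show "f \<one>\<^bsub>G\<^esub> = 2"
        using zero[of "p \<one>\<^bsub>G\<^esub> - 2"]
        by (simp add: P_def f_def eval_int_mpoly_diff)
      fix g h assume "g \<in> carrier G" "h \<in> carrier G"
      hence "p g * p h - p (g \<otimes>\<^bsub>G\<^esub> h) - p (g \<otimes>\<^bsub>G\<^esub> inv\<^bsub>G\<^esub> h) \<in> P" unfolding P_def by blast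
      from zero[OF this] show "f g * f h = f (g \<otimes>\<^bsub>G\<^esub> h) + f (g \<otimes>\<^bsub>G\<^esub> inv\<^bsub>G\<^esub> h)"
        by (simp add: f_def eval_int_mpoly_add eval_int_mpoly_diff eval_int_mpoly_mult diff_diff_eq)
    qed
    then obtain \<rho> where \<rho>: "\<rho> \<in> hom G SL2" "\<And>g. g \<in> carrier G \<Longrightarrow> trace (\<rho> g) = f g"
      using trace_function.trace_function_imp_character[OF _ assms(2)] by blast
    have "v \<in> extensional F" using v by (auto simp: zero_locus_def PiE_def)
    have "restrict (character G \<rho>) F = v"
    proof (rule extensionalityI[OF _ \<open>v \<in> extensional F\<close>])
      fix g assume g: "g \<in> F"
      have "mpoly_var g - p g \<in> P" using g unfolding P_def by blast
      from zero[OF this] have "v g = f g" by (simp add: f_def eval_int_mpoly_diff)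
      thus "restrict (character G \<rho>) F g = v g" using g F \<rho>(2) by (auto simp: character_def)
    qed simp
    thus "v \<in> (\<lambda>f. restrict f F) ` (SL2_characters G :: ('g \<Rightarrow> 'k) set)"
      using \<rho>(1) unfolding SL2_characters_def by blast
  qed
  ultimately show ?thesis using \<open>finite F\<close> F by blast
qed

end
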